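(* Let $(X,d)$ be a compact metric space with binary entropy $\eta$ and relative binary entropies $\eta_m$ ($m\in\mathbb N$), and let $(n_k)_{k\in\mathbb N}$ be a strictly increasing sequence of positive integers. Put $n_{-1}:=-\infty$ and define $\mu:\mathbb N\to\mathbb N$ by $$\mu(n):=\eta(1+n_0)+\sum_{k=0}^{K}\eta_{n_k}(1+n_{k+1})\qquad\text{for } n_{K-1}<n\le n_K .$$ (i) Suppose there is $c\in\mathbb N$ such that $n_{k+1}\le c+c\cdot n_k$ for all $k$ and $\mu(n_K)\le\eta(c+c\cdot n_K)$ for all $K$. Then $X$ admits a linearly standard representation $\xi:\subseteq\mathcal C\twoheadrightarrow X$ with modulus of continuity $\mu$. (ii) Suppose there is $c\in\mathbb N$ such that $n_{k+1}\le c+c\cdot n_k^{\,c}$ for all $k$ and $\mu(n_K)\le\eta(c+c\cdot n_K^{\,c})$ for all $K$. Then $X$ admits a polynomially standard representation $\xi:\subseteq\mathcal C\twoheadrightarrow X$ with modulus of continuity $\mu$.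
   Context: $\mathbb N=\{0,1,2,\dots\}$. Cantor space $\mathcal C=\{0,1\}^{\mathbb N}$ carries the metric $D(\bar u,\bar v)=2^{-\min\{n:u_n\neq v_n\}}$ for $\bar u\ne\bar v$, and $D(\bar u,\bar u)=0$. Modulus: a modulus of continuity of $f:(X,d)\to(Y,e)$ is a non-decreasing $\mu:\mathbb N\to\mathbb N$ such that for all $n$ and all $x,x'$: $d(x,x')\le2^{-\mu(n)}$ implies $e(f(x),f(x'))\le2^{-n}$. For a partial map, $x,x'$ range over its domain (a metric subspace). The minimal modulus is the pointwise least one. Entropy: the unary entropy $\hat\eta_X(n)$ of a compact metric space $X$ is the least number of closed balls of radius $2^{-n}$ with centers in $X$ that cover $X$; the binary entropy is $\eta_X(n)=\lceil\log_2\hat\eta_X(n)\rceil$ (written $\eta$). The relative unary entropy is $\hat\eta_m(n)=\sup_{x\in X}\hat\eta_{\overline B(x,2^{-m})}(n)$, where $\overline B(x,r)=\{x':d(x,x')\le r\}$ is regarded as a metric subspace; the relative binary entropy is $\eta_m(n)=\lceil\log_2\hat\eta_m(n)\rceil$. Representation: a surjective partial map $\xi:\subseteq\mathcal C\twoheadrightarrow X$. The induced semi-metric is $d_\xi(x,x')=\min\{D(u,u'):\xi(u)=x,\ \xi(u')=x'\}$. Reductions: let $\xi,\xi':\subseteq\mathcal C\to X$ be partial maps (not necessarily surjective) with minimal moduli of continuity $\mu_\xi,\mu_{\xi'}$. A polynomial (resp. linear) reduction from $\xi'$ to $\xi$ is a map $G:\mathrm{dom}(\xi')\to\mathrm{dom}(\xi)$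 with a modulus of continuity $\nu$ such that $\xi'(u)=\xi(G(u))$ for all $u\in\mathrm{dom}(\xi')$ and, for some $c\in\mathbb N$ and all $n$, $\nu(\mu_\xi(n))\le\mu_{\xi'}(c+c\,n^c)$ (resp. $\nu(\mu_\xi(n))\le\mu_{\xi'}(c+c\,n)$). A representation $\xi:\subseteq\mathcal C\twoheadrightarrow X$ with minimal modulus $\mu_\xi$ is polynomially standard if: (1) for some $c$ and all $n$, $\mu_\xi(n)\le\eta(c+c\,n^c)$; (2') every (not necessarily surjective) partial $\xi':\subseteq\mathcal C\to X$ possessing a modulus of continuity has a polynomial reduction to $\xi$; and (3) there is a polynomial $p$ with natural-number coefficients such that for all $n$ and $x,x'\in X$, $d(x,x')\le2^{-p(n)}$ implies $d_\xi(x,x')\le2^{-\eta(n)}$. It is linearly standard if the same holds with $c+c\,n$ in place of $c+c\,n^c$, linear in place of polynomial reductions, and $p(n)$ of the form $c+c\,n$. *)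

theory Defs
  imports "HOL-Analysis.Analysis" "HOL-Computational_Algebra.Polynomial"
begin

text \<open>
  Metrics are passed explicitly as distance functions on a carrier set, as in the locale
  \<^locale>\<open>Metric_space\<close>: a metric subspace is a subset of the carrier with the same distance
  function, and Cantor space carries its own metric rather than the one of the instance of
  \<^class>\<open>metric_space\<close> for functions.
\<close>

section \<open>Moduli of continuity\<close>

definition modulus_of ::
  "'a set \<Rightarrow> ('a \<Rightarrow> 'a \<Rightarrow> real) \<Rightarrow> ('b \<Rightarrow> 'b \<Rightarrow> real) \<Rightarrow> ('a \<Rightarrow> 'b) \<Rightarrow> (nat \<Rightarrow> nat) \<Rightarrow> bool"
  where "modulus_of S d e f \<mu> \<longleftrightarrow>
    mono \<mu> \<and> (\<forall>n. \<forall>x\<in>S. \<forall>x'\<in>S. d x x' \<le> (1/2) ^ \<mu> n \<longrightarrow> e (f x) (f x') \<le> (1/2) ^ n)"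

text \<open>
  The least element is taken in the pointwise order on functions. It exists as soon as there is
  some modulus of continuity; otherwise the value is unspecified.
\<close>

definition minimal_modulus ::
  "'a set \<Rightarrow> ('a \<Rightarrow> 'a \<Rightarrow> real) \<Rightarrow> ('b \<Rightarrow> 'b \<Rightarrow> real) \<Rightarrow> ('a \<Rightarrow> 'b) \<Rightarrow> (nat \<Rightarrow> nat)"
  where "minimal_modulus S d e f = (LEAST \<mu>. modulus_of S d e f \<mu>)"

section \<open>Entropy\<close>

definition unary_entropy :: "'a set \<Rightarrow> ('a \<Rightarrow> 'a \<Rightarrow> real) \<Rightarrow> nat \<Rightarrow> nat"
  where "unary_entropy X d n =
    (LEAST k. \<exists>C. finite C \<and> C \<subseteq> X \<and> card C = k \<and>
       X \<subseteq> (\<Union>c\<in>C. Metric_space.mcball X d c ((1/2) ^ n)))"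

definition binary_entropy :: "'a set \<Rightarrow> ('a \<Rightarrow> 'a \<Rightarrow> real) \<Rightarrow> nat \<Rightarrow> nat"
  where "binary_entropy X d n = nat \<lceil>log 2 (real (unary_entropy X d n))\<rceil>"

definition relative_unary_entropy :: "'a set \<Rightarrow> ('a \<Rightarrow> 'a \<Rightarrow> real) \<Rightarrow> nat \<Rightarrow> nat \<Rightarrow> nat"
  where "relative_unary_entropy X d m n =
    (SUP x\<in>X. unary_entropy (Metric_space.mcball X d x ((1/2) ^ m)) d n)"

definition relative_binary_entropy :: "'a set \<Rightarrow> ('a \<Rightarrow> 'a \<Rightarrow> real) \<Rightarrow> nat \<Rightarrow> nat \<Rightarrow> nat"
  where "relative_binary_entropy X d m n =
    nat \<lceil>log 2 (real (relative_unary_entropy X d m n))\<rceil>"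

section \<open>Cantor space and representations\<close>

type_synonym cantor = "nat \<Rightarrow> bool"

definition cantor_dist :: "cantor \<Rightarrow> cantor \<Rightarrow> real"
  where "cantor_dist u v = (if u = v then 0 else (1/2) ^ (LEAST n. u n \<noteq> v n))"

definition map_modulus ::
  "('a \<Rightarrow> 'a \<Rightarrow> real) \<Rightarrow> (cantor \<rightharpoonup> 'a) \<Rightarrow> (nat \<Rightarrow> nat) \<Rightarrow> bool"
  where "map_modulus d \<xi> \<mu> \<longleftrightarrow> modulus_of (dom \<xi>) cantor_dist d (the \<circ> \<xi>) \<mu>"

definition map_min_modulus :: "('a \<Rightarrow> 'a \<Rightarrow> real) \<Rightarrow> (cantor \<rightharpoonup> 'a) \<Rightarrow> (nat \<Rightarrow> nat)"
  where "map_min_modulus d \<xi> = minimal_modulus (dom \<xi>) cantor_dist d (the \<circ> \<xi>)"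

definition representation_of :: "'a set \<Rightarrow> (cantor \<rightharpoonup> 'a) \<Rightarrow> bool"
  where "representation_of X \<xi> \<longleftrightarrow> ran \<xi> = X"

text \<open>
  For surjective \<open>\<xi>\<close> with a modulus of continuity the minimum is attained: positive values of
  \<^term>\<open>cantor_dist\<close> can only accumulate at \<open>0\<close>, and for \<open>x \<noteq> x'\<close> they are bounded away from \<open>0\<close>.
\<close>

definition induced_semimetric :: "(cantor \<rightharpoonup> 'a) \<Rightarrow> 'a \<Rightarrow> 'a \<Rightarrow> real"
  where "induced_semimetric \<xi> x x' =
    (LEAST r. \<exists>u u'. \<xi> u = Some x \<and> \<xi> u' = Some x' \<and> r = cantor_dist u u')"

section \<open>Reductions and standard representations\<close>

text \<open>
  The parameter \<open>b\<close> is the family of admissible bounds on the growth: a polynomial reduction has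
  \<open>b c n = c + c * n ^ c\<close> and a linear one \<open>b c n = c + c * n\<close>.
\<close>

definition reducible ::
  "(nat \<Rightarrow> nat \<Rightarrow> nat) \<Rightarrow> ('a \<Rightarrow> 'a \<Rightarrow> real) \<Rightarrow> (cantor \<rightharpoonup> 'a) \<Rightarrow> (cantor \<rightharpoonup> 'a) \<Rightarrow> bool"
  where "reducible b d \<xi>' \<xi> \<longleftrightarrow>
    (\<exists>G \<nu>. G \<in> dom \<xi>' \<rightarrow> dom \<xi> \<and>
       modulus_of (dom \<xi>') cantor_dist cantor_dist G \<nu> \<and>
       (\<forall>u\<in>dom \<xi>'. \<xi>' u = \<xi> (G u)) \<and>
       (\<exists>c. \<forall>n. \<nu> (map_min_modulus d \<xi> n) \<le> map_min_modulus d \<xi>' (b c n)))"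

definition polynomially_reducible ::
  "('a \<Rightarrow> 'a \<Rightarrow> real) \<Rightarrow> (cantor \<rightharpoonup> 'a) \<Rightarrow> (cantor \<rightharpoonup> 'a) \<Rightarrow> bool"
  where "polynomially_reducible = reducible (\<lambda>c n. c + c * n ^ c)"

definition linearly_reducible ::
  "('a \<Rightarrow> 'a \<Rightarrow> real) \<Rightarrow> (cantor \<rightharpoonup> 'a) \<Rightarrow> (cantor \<rightharpoonup> 'a) \<Rightarrow> bool"
  where "linearly_reducible = reducible (\<lambda>c n. c + c * n)"

definition polynomially_standard :: "'a set \<Rightarrow> ('a \<Rightarrow> 'a \<Rightarrow> real) \<Rightarrow> (cantor \<rightharpoonup> 'a) \<Rightarrow> bool"
  where "polynomially_standard X d \<xi> \<longleftrightarrow>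
    representation_of X \<xi> \<and> (\<exists>\<mu>. map_modulus d \<xi> \<mu>) \<and>
    (\<exists>c. \<forall>n. map_min_modulus d \<xi> n \<le> binary_entropy X d (c + c * n ^ c)) \<and>
    (\<forall>\<xi>'. ran \<xi>' \<subseteq> X \<and> (\<exists>\<mu>. map_modulus d \<xi>' \<mu>) \<longrightarrow> polynomially_reducible d \<xi>' \<xi>) \<and>
    (\<exists>p :: nat poly. \<forall>n. \<forall>x\<in>X. \<forall>x'\<in>X.
       d x x' \<le> (1/2) ^ poly p n \<longrightarrow>
       induced_semimetric \<xi> x x' \<le> (1/2) ^ binary_entropy X d n)"

definition linearly_standard :: "'a set \<Rightarrow> ('a \<Rightarrow> 'a \<Rightarrow> real) \<Rightarrow> (cantor \<rightharpoonup> 'a) \<Rightarrow> bool"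
  where "linearly_standard X d \<xi> \<longleftrightarrow>
    representation_of X \<xi> \<and> (\<exists>\<mu>. map_modulus d \<xi> \<mu>) \<and>
    (\<exists>c. \<forall>n. map_min_modulus d \<xi> n \<le> binary_entropy X d (c + c * n)) \<and>
    (\<forall>\<xi>'. ran \<xi>' \<subseteq> X \<and> (\<exists>\<mu>. map_modulus d \<xi>' \<mu>) \<longrightarrow> linearly_reducible d \<xi>' \<xi>) \<and>
    (\<exists>c. \<forall>n. \<forall>x\<in>X. \<forall>x'\<in>X.
       d x x' \<le> (1/2) ^ (c + c * n) \<longrightarrow>
       induced_semimetric \<xi> x x' \<le> (1/2) ^ binary_entropy X d n)"

section \<open>The modulus attached to a sequence of precisions\<close>

text \<open>
  For strictly increasing \<open>N\<close>, the \<open>K\<close> below is the one with \<open>N (K - 1) < n \<le> N K\<close>, where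
  \<open>N (-1)\<close> is read as minus infinity.
\<close>

definition sequence_modulus ::
  "'a set \<Rightarrow> ('a \<Rightarrow> 'a \<Rightarrow> real) \<Rightarrow> (nat \<Rightarrow> nat) \<Rightarrow> nat \<Rightarrow> nat"
  where "sequence_modulus X d N n =
    (let K = (LEAST K. n \<le> N K) in
      binary_entropy X d (1 + N 0) +
      (\<Sum>k=0..K. relative_binary_entropy X d (N k) (1 + N (Suc k))))"

end

theory Submission
  imports Defs
begin

text \<open>
  A name of \<open>x\<close> is a path through a tree of points. The children of a node \<open>z\<close> of precision
  \<open>N k\<close> form a net of mesh \<open>(1/2) ^ (1 + N (k + 1))\<close> in the ball of radius \<open>(1/2) ^ N k\<close> around
  \<open>z\<close>, so as many digits as the relative entropy says select a child. An infinite path names \<open>x\<close>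
  if each of its nodes, of precision \<open>N k\<close> say, is within \<open>(1/2) ^ N k\<close> of \<open>x\<close>: this is twice the
  mesh used to choose the node. Two points with a common node of precision \<open>N (k + 1)\<close> are at
  distance at most \<open>(1/2) ^ N k\<close>, which gives the modulus. The factor of two makes names flexible.
  If \<open>x'\<close> is within \<open>(1/2) ^ (1 + N k)\<close> of \<open>x\<close>, a greedy name of \<open>x\<close> can be redirected to \<open>x'\<close>
  below precision \<open>N k\<close>. A name in another representation can be translated block by block, because
  an initial segment of it that determines the point up to \<open>(1/2) ^ (1 + N k)\<close> suffices to select
  the node of precision \<open>N k\<close>. The growth conditions turn these statements at the precisions \<open>N k\<close>
  into bounds at all precisions.
\<close>

section \<open>Moduli of continuity\<close>

text \<open>Turns distances in Cantor space into agreement of initial segments, the form in which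
  moduli are checked below.\<close>

lemma cantor_dist_le_iff: "cantor_dist u v \<le> (1/2) ^ m \<longleftrightarrow> (\<forall>i<m. u i = v i)"
proof (cases "u = v")
  case False
  then obtain n where "u n \<noteq> v n"
    by auto
  then have least: "u (LEAST n. u n \<noteq> v n) \<noteq> v (LEAST n. u n \<noteq> v n)"
    by (rule LeastI)
  have "cantor_dist u v \<le> (1/2) ^ m \<longleftrightarrow> m \<le> (LEAST n. u n \<noteq> v n)"
    using False by (simp add: cantor_dist_def)
  also have "\<dots> \<longleftrightarrow> (\<forall>i<m. u i = v i)"
    using least not_less_Least[of _ "\<lambda>n. u n \<noteq> v n"] by (meson leI order_less_le_trans)
  finally show ?thesis .
qed (simp add: cantor_dist_def)

lemma cantor_dist_nonneg: "0 \<le> cantor_dist u v"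
  by (simp add: cantor_dist_def)

text \<open>
  The exponents that are admissible for a fixed target precision form an up-closed set of
  naturals, so their minima already form a modulus, and it is the least one.
\<close>

lemma minimal_modulus_exists:
  fixes d :: "'a \<Rightarrow> 'a \<Rightarrow> real" and e :: "'b \<Rightarrow> 'b \<Rightarrow> real"
  assumes "\<And>n. \<exists>m. \<forall>x\<in>S. \<forall>x'\<in>S. d x x' \<le> (1/2) ^ m \<longrightarrow> e (f x) (f x') \<le> (1/2) ^ n"
  shows modulus_of_minimal: "modulus_of S d e f (minimal_modulus S d e f)"
    and minimal_modulus_le:
      "\<And>n m. (\<And>x x'. x \<in> S \<Longrightarrow> x' \<in> S \<Longrightarrow> d x x' \<le> (1/2) ^ m \<Longrightarrow> e (f x) (f x') \<le> (1/2) ^ n)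
        \<Longrightarrow> minimal_modulus S d e f n \<le> m"
proof -
  define P where "P n m \<longleftrightarrow> (\<forall>x\<in>S. \<forall>x'\<in>S. d x x' \<le> (1/2) ^ m \<longrightarrow> e (f x) (f x') \<le> (1/2) ^ n)"
    for n m :: nat
  define \<mu> where "\<mu> n = (LEAST m. P n m)" for n
  have P: "P n (\<mu> n)" for n
    unfolding \<mu>_def by (rule LeastI_ex) (use assms[of n] in \<open>simp add: P_def\<close>)
  have least: "P n m \<Longrightarrow> \<mu> n \<le> m" for n m
    unfolding \<mu>_def by (rule Least_le)
  have anti: "P n m" if "P n' m" "n \<le> n'" for n n' m
  proof -
    have "(1/2 :: real) ^ n' \<le> (1/2) ^ n"
      using that(2) by (intro power_decreasing) auto
    then show ?thesis
      using that(1) unfolding P_def by (meson order_trans)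
  qed
  have "mono \<mu>"
    by (intro monoI least anti[OF P])
  with P have "modulus_of S d e f \<mu>"
    by (simp add: modulus_of_def P_def)
  moreover have "\<mu> \<le> \<mu>'" if "modulus_of S d e f \<mu>'" for \<mu>'
  proof (intro le_funI least)
    show "P n (\<mu>' n)" for n
      using that by (simp add: modulus_of_def P_def)
  qed
  ultimately have "minimal_modulus S d e f = \<mu>"
    unfolding minimal_modulus_def by (rule Least_equality)
  with \<open>modulus_of S d e f \<mu>\<close> show "modulus_of S d e f (minimal_modulus S d e f)"
    and "(\<And>x x'. x \<in> S \<Longrightarrow> x' \<in> S \<Longrightarrow> d x x' \<le> (1/2) ^ m \<Longrightarrow> e (f x) (f x') \<le> (1/2) ^ n)
        \<Longrightarrow> minimal_modulus S d e f n \<le> m" for n m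
    by (simp_all add: least P_def)
qed

lemma modulus_of_bound_exists:
  "modulus_of S d e f \<mu> \<Longrightarrow>
    \<exists>m. \<forall>x\<in>S. \<forall>x'\<in>S. d x x' \<le> (1/2) ^ m \<longrightarrow> e (f x) (f x') \<le> (1/2) ^ n"
  unfolding modulus_of_def by blast

lemma map_min_modulus_le:
  assumes "map_modulus d \<xi> \<mu>"
  shows "map_min_modulus d \<xi> n \<le> \<mu> n"
  unfolding map_min_modulus_def
  using assms unfolding map_modulus_def
  by (intro minimal_modulus_le[OF modulus_of_bound_exists]) (auto simp: modulus_of_def)

lemma map_modulus_min:
  "map_modulus d \<xi> \<mu> \<Longrightarrow> map_modulus d \<xi> (map_min_modulus d \<xi>)"
  unfolding map_modulus_def map_min_modulus_def
  by (rule modulus_of_minimal[OF modulus_of_bound_exists])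

lemma map_modulusD:
  assumes "map_modulus d \<xi> \<mu>" "\<xi> u = Some x" "\<xi> u' = Some x'" "\<forall>i<\<mu> n. u i = u' i"
  shows "d x x' \<le> (1/2) ^ n"
proof -
  have "u \<in> dom \<xi>" "u' \<in> dom \<xi>" "cantor_dist u u' \<le> (1/2) ^ \<mu> n"
    using assms by (auto simp: cantor_dist_le_iff)
  with assms(1) have "d ((the \<circ> \<xi>) u) ((the \<circ> \<xi>) u') \<le> (1/2) ^ n"
    unfolding map_modulus_def modulus_of_def by blast
  with assms show ?thesis
    by simp
qed

text \<open>A \<open>LEAST\<close> over the reals is a lower bound only if the minimum is attained.
  For x = x' it is 0. For x \<noteq> x' the modulus keeps names of the two points from agreeing too
  long, so only finitely many powers of 1/2 occur as distances.\<close>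

lemma induced_semimetric_le:
  assumes X: "Metric_space X d" and "ran \<xi> \<subseteq> X" and \<mu>: "map_modulus d \<xi> \<mu>"
    and u: "\<xi> u = Some x" "\<xi> u' = Some x'"
  shows "induced_semimetric \<xi> x x' \<le> cantor_dist u u'"
proof -
  define P where "P r \<longleftrightarrow> (\<exists>u u'. \<xi> u = Some x \<and> \<xi> u' = Some x' \<and> r = cantor_dist u u')" for r
  have ind: "induced_semimetric \<xi> x x' = (LEAST r. P r)"
    by (simp add: induced_semimetric_def P_def)
  have Pu: "P (cantor_dist u u')"
    using u by (auto simp: P_def)
  have "x \<in> X" "x' \<in> X"
    using assms(2) u by (auto intro: ranI)
  show ?thesis
  proof (cases "x = x'")
    case True
    then have "P (cantor_dist u u)"
      unfolding P_def using u by blast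
    then have "P 0"
      by (simp add: cantor_dist_def)
    then have "(LEAST r. P r) = 0"
      by (rule Least_equality) (auto simp: P_def cantor_dist_nonneg)
    then show ?thesis
      by (simp add: ind cantor_dist_nonneg)
  next
    case False
    then have "0 < d x x'"
      using \<open>x \<in> X\<close> \<open>x' \<in> X\<close> by (rule Metric_space.mdist_pos_less[OF X])
    then obtain n where n: "(1/2) ^ n < d x x'"
      using real_arch_pow_inv[of "d x x'" "1/2"] by fastforce
    have "{r. P r} \<subseteq> (\<lambda>m. (1/2) ^ m) ` {..<\<mu> n}"
    proof
      fix r assume "r \<in> {r. P r}"
      then obtain v v' where v: "\<xi> v = Some x" "\<xi> v' = Some x'" "r = cantor_dist v v'"
        by (auto simp: P_def)
      define m where "m = (LEAST n. v n \<noteq> v' n)"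
      have r: "r = (1/2) ^ m"
        using v False by (auto simp: cantor_dist_def m_def)
      have "\<not> r \<le> (1/2) ^ \<mu> n"
        using map_modulusD[OF \<mu> v(1,2), of n] n unfolding v(3) cantor_dist_le_iff by (meson not_le)
      then have "m < \<mu> n"
        by (simp add: r)
      with r show "r \<in> (\<lambda>m. (1/2) ^ m) ` {..<\<mu> n}"
        by blast
    qed
    then have "finite {r. P r}"
      by (rule finite_subset) simp
    moreover from this have "(LEAST r. P r) = Min {r. P r}"
      by (rule Least_Min) (rule exI[of P, OF Pu])
    ultimately show ?thesis
      unfolding ind using Pu by simp
  qed
qed

section \<open>Nets and entropy\<close>

lemma nat_ceiling_log2_le: "k \<le> 2 ^ m \<Longrightarrow> nat \<lceil>log 2 (real k)\<rceil> \<le> m"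
proof (cases "k = 0")
  case False
  assume "k \<le> 2 ^ m"
  then have "real k \<le> 2 ^ m"
    using of_nat_mono by fastforce
  with False have "log 2 (real k) \<le> real m"
    by (subst log_le_iff) (simp_all add: powr_realpow)
  then show ?thesis
    by linarith
\<comment> \<open>For \<open>k = 0\<close> the claim rests on the convention that the logarithm of 0
  is 0.\<close>
qed (simp add: log_def)

lemma le_2_power_nat_ceiling_log2: "k \<le> 2 ^ nat \<lceil>log 2 (real k)\<rceil>"
proof (cases "k = 0")
  case False
  then have "log 2 (real k) \<le> real (nat \<lceil>log 2 (real k)\<rceil>)"
    by linarith
  with False have "real k \<le> 2 powr real (nat \<lceil>log 2 (real k)\<rceil>)"
    by (subst (asm) log_le_iff) simp_all
  then have "real k \<le> 2 ^ nat \<lceil>log 2 (real k)\<rceil>"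
    by (simp add: powr_realpow)
  then show ?thesis
    by (metis of_nat_le_iff of_nat_numeral of_nat_power)
qed simp

lemma unary_entropy_le_2_power: "unary_entropy A d n \<le> 2 ^ binary_entropy A d n"
  by (simp add: binary_entropy_def le_2_power_nat_ceiling_log2)

lemma (in Metric_space) unary_entropy_le:
  assumes "A \<subseteq> M" "finite C" "C \<subseteq> A" "\<And>y. y \<in> A \<Longrightarrow> \<exists>c\<in>C. d c y \<le> (1/2) ^ n"
  shows "unary_entropy A d n \<le> card C"
proof -
  interpret A: Metric_space A d
    using assms(1) by (rule subspace)
  show ?thesis
    unfolding unary_entropy_def using assms(2-) by (intro Least_le exI[of _ C]) fastforce
qed

lemma (in Metric_space) unary_entropy_attained:
  assumes "A \<subseteq> M" "finite B" "B \<subseteq> A" "\<And>y. y \<in> A \<Longrightarrow> \<exists>c\<in>B. d c y \<le> (1/2) ^ n"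
  obtains C where "finite C" "C \<subseteq> A" "card C = unary_entropy A d n"
    "\<And>y. y \<in> A \<Longrightarrow> \<exists>c\<in>C. d c y \<le> (1/2) ^ n"
proof -
  interpret A: Metric_space A d
    using assms(1) by (rule subspace)
  have "\<exists>k C. finite C \<and> C \<subseteq> A \<and> card C = k \<and> A \<subseteq> (\<Union>c\<in>C. A.mcball c ((1/2) ^ n))"
    using assms(2-) by (intro exI[of _ "card B"] exI[of _ B]) fastforce
  from LeastI_ex[OF this] obtain C where C: "finite C" "C \<subseteq> A" "card C = unary_entropy A d n"
    "A \<subseteq> (\<Union>c\<in>C. A.mcball c ((1/2) ^ n))"
    unfolding unary_entropy_def by blast
  moreover have "\<exists>c\<in>C. d c y \<le> (1/2) ^ n" if "y \<in> A" for y
    using C(4) that by (auto dest!: subsetD[of A])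
  ultimately show thesis
    by (intro that)
qed

locale compact_metric_space = Metric_space X d for X :: "'a set" and d +
  assumes compact: "compact_space mtopology"
begin

text \<open>Total boundedness gives centers in the whole space, at the doubled precision
  \<open>Suc n\<close>. Moving each useful center into \<open>A\<close> by \<open>g\<close> spends
  the other half of the radius. The bound \<open>card K\<close> is the same for all
  \<open>A\<close>.\<close>

lemma finite_net:
  "\<exists>k. \<forall>A\<subseteq>X. \<exists>B. finite B \<and> card B \<le> k \<and> B \<subseteq> A \<and> (\<forall>y\<in>A. \<exists>c\<in>B. d c y \<le> (1/2) ^ n)"
proof -
  have "mtotally_bounded X"
    using compact compactin_imp_mtotally_bounded by (metis compact_space_def topspace_mtopology)
  moreover have "(1/2 :: real) ^ Suc n > 0"
    by simp
  ultimately obtain K where K: "finite K" "X \<subseteq> (\<Union>x\<in>K. mball x ((1/2) ^ Suc n))"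
    unfolding mtotally_bounded_def by meson
  show ?thesis
  proof (intro exI[of _ "card K"] allI impI)
    fix A assume "A \<subseteq> X"
    define g where "g c = (SOME a. a \<in> A \<and> d c a < (1/2) ^ Suc n)" for c
    have g: "g c \<in> A \<and> d c (g c) < (1/2) ^ Suc n" if "a \<in> A" "d c a < (1/2) ^ Suc n" for c a
      unfolding g_def by (rule someI[of _ a]) (use that in simp)
    define J where "J = {c \<in> K. c \<in> X \<and> (\<exists>a\<in>A. d c a < (1/2) ^ Suc n)}"
    have "\<exists>c\<in>g ` J. d c y \<le> (1/2) ^ n" if y: "y \<in> A" for y
    proof -
      obtain c where c: "c \<in> K" "c \<in> X" "d c y < (1/2) ^ Suc n"
        using subsetD[OF K(2) subsetD[OF \<open>A \<subseteq> X\<close> y]] by auto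
      from g[OF y c(3)] have gc: "g c \<in> A" "d c (g c) < (1/2) ^ Suc n"
        by auto
      have "d (g c) y \<le> d c (g c) + d c y"
        using triangle[of "g c" c y] commute[of "g c" c] c(2) gc(1) y \<open>A \<subseteq> X\<close> by auto
      with c gc have "d (g c) y \<le> (1/2) ^ n"
        by simp
      moreover have "c \<in> J"
        unfolding J_def using c y by blast
      ultimately show ?thesis
        by blast
    qed
    moreover have "g ` J \<subseteq> A"
      unfolding J_def using g by blast
    moreover have "J \<subseteq> K"
      by (auto simp: J_def)
    then have "finite (g ` J)" "card (g ` J) \<le> card K"
      using K(1) by (auto intro: finite_subset surj_card_le card_image_le[THEN order_trans] card_mono)
    ultimately show "\<exists>B. finite B \<and> card B \<le> card K \<and> B \<subseteq> A \<and> (\<forall>y\<in>A. \<exists>c\<in>B. d c y \<le> (1/2) ^ n)"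
      by (intro exI[of _ "g ` J"]) auto
  qed
qed

lemma unary_entropy_net:
  assumes "A \<subseteq> X"
  obtains C where "finite C" "C \<subseteq> A" "card C = unary_entropy A d n"
    "\<And>y. y \<in> A \<Longrightarrow> \<exists>c\<in>C. d c y \<le> (1/2) ^ n"
proof -
  obtain B where B: "finite B" "B \<subseteq> A" "\<forall>y\<in>A. \<exists>c\<in>B. d c y \<le> (1/2) ^ n"
    using finite_net[of n] assms by auto
  show thesis
    by (rule unary_entropy_attained[OF assms B(1,2)]) (use B(3) that in auto)
qed

lemma binary_entropy_mono:
  assumes "m \<le> n"
  shows "binary_entropy X d m \<le> binary_entropy X d n"
proof -
  obtain C where C: "finite C" "C \<subseteq> X" "card C = unary_entropy X d n"
    "\<And>y. y \<in> X \<Longrightarrow> \<exists>c\<in>C. d c y \<le> (1/2) ^ n"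
    using unary_entropy_net by blast
  have "(1/2 :: real) ^ n \<le> (1/2) ^ m"
    using assms by (simp add: power_decreasing)
  with C(4) have "\<exists>c\<in>C. d c y \<le> (1/2) ^ m" if "y \<in> X" for y
    using that order_trans by blast
  with C have "unary_entropy X d m \<le> card C"
    by (intro unary_entropy_le) auto
  also have "card C \<le> 2 ^ binary_entropy X d n"
    by (simp add: C(3) unary_entropy_le_2_power)
  finally have "unary_entropy X d m \<le> 2 ^ binary_entropy X d n" .
  then show ?thesis
    unfolding binary_entropy_def[of X d m] by (rule nat_ceiling_log2_le)
qed

text \<open>A \<open>SUP\<close> of naturals is an upper bound only for bounded families; the bound
  from \<open>finite_net\<close>, uniform over all subsets, supplies this.\<close>

lemma unary_entropy_mcball_le:
  assumes "x \<in> X"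
  shows "unary_entropy (mcball x ((1/2) ^ m)) d n \<le> 2 ^ relative_binary_entropy X d m n"
proof -
  obtain n0 where n0: "\<forall>A\<subseteq>X. \<exists>B. finite B \<and> card B \<le> n0 \<and> B \<subseteq> A \<and> (\<forall>y\<in>A. \<exists>c\<in>B. d c y \<le> (1/2) ^ n)"
    using finite_net ..
  have "unary_entropy A d n \<le> n0" if A: "A \<subseteq> X" for A
  proof -
    obtain B where "finite B" "card B \<le> n0" "B \<subseteq> A" "\<forall>y\<in>A. \<exists>c\<in>B. d c y \<le> (1/2) ^ n"
      using n0[rule_format, OF A] by auto
    with unary_entropy_le[OF A, of B n] show ?thesis
      by (meson order_trans)
  qed
  then have "bdd_above ((\<lambda>x. unary_entropy (mcball x ((1/2) ^ m)) d n) ` X)"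
    by (intro bdd_aboveI2[of _ _ n0]) (simp add: mcball_subset_mspace)
  then have "unary_entropy (mcball x ((1/2) ^ m)) d n \<le> relative_unary_entropy X d m n"
    unfolding relative_unary_entropy_def using assms by (rule cSUP_upper2) simp
  also have "\<dots> \<le> 2 ^ relative_binary_entropy X d m n"
    by (simp add: relative_binary_entropy_def le_2_power_nat_ceiling_log2)
  finally show ?thesis .
qed

text \<open>A smallest net embeds in the words of length \<open>e\<close>, and \<open>f\<close>
  inverts the embedding. All other words, of whatever length, go to one fixed point of
  \<open>A\<close>, so that every word selects a point.\<close>

lemma net_indexed_by_words:
  assumes "A \<subseteq> X" "A \<noteq> {}" "unary_entropy A d n \<le> 2 ^ e"
  shows "\<exists>f :: bool list \<Rightarrow> 'a. range f \<subseteq> X \<and> (\<forall>y\<in>A. \<exists>w. length w = e \<and> d (f w) y \<le> (1/2) ^ n)"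
proof -
  obtain C where C: "finite C" "C \<subseteq> A" "card C = unary_entropy A d n"
    "\<And>y. y \<in> A \<Longrightarrow> \<exists>c\<in>C. d c y \<le> (1/2) ^ n"
    using unary_entropy_net[OF assms(1)] by blast
  have "card {w :: bool list. length w = e} = 2 ^ e" "finite {w :: bool list. length w = e}"
    using card_lists_length_eq[of "UNIV :: bool set" e] finite_lists_length_eq[of "UNIV :: bool set" e]
    by simp_all
  then obtain g where g: "g ` C \<subseteq> {w :: bool list. length w = e}" "inj_on g C"
    using card_le_inj[of C "{w :: bool list. length w = e}"] C assms(3) by auto
  obtain a where "a \<in> A"
    using assms(2) by blast
  define f where "f w = (if w \<in> g ` C then inv_into C g w else a)" for w
  have "f w \<in> A" for w
    using C(2) \<open>a \<in> A\<close> inv_into_into[of w g C] by (auto simp: f_def)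
  moreover have "\<exists>w. length w = e \<and> d (f w) y \<le> (1/2) ^ n" if y: "y \<in> A" for y
  proof -
    obtain c where "c \<in> C" "d c y \<le> (1/2) ^ n"
      using C(4)[OF y] by blast
    then show ?thesis
      using g by (intro exI[of _ "g c"]) (auto simp: f_def)
  qed
  ultimately show ?thesis
    using assms(1) by (intro exI[of _ f]) blast
qed

end


section \<open>The tree representation\<close>

locale precision_sequence = compact_metric_space X d for X :: "'a set" and d +
  fixes N :: "nat \<Rightarrow> nat"
  assumes strict_mono_N: "strict_mono N"
begin

text \<open>
  A word of length \<open>width k\<close> selects a child of a node of depth \<open>k\<close>. The children of \<open>x\<close> form a net
  for \<open>target k x\<close> that is twice as fine as what membership in the domain of the representation
  demands; this slack is what lets nearby points share an initial segment of their names.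
\<close>

definition target :: "nat \<Rightarrow> 'a \<Rightarrow> 'a set"
  where "target k x = (case k of 0 \<Rightarrow> X | Suc j \<Rightarrow> mcball x ((1/2) ^ N j))"

definition width :: "nat \<Rightarrow> nat"
  where "width k = (case k of 0 \<Rightarrow> binary_entropy X d (1 + N 0)
    | Suc j \<Rightarrow> relative_binary_entropy X d (N j) (1 + N (Suc j)))"

definition offset :: "nat \<Rightarrow> nat"
  where "offset k = (\<Sum>j<k. width j)"

definition child :: "nat \<Rightarrow> 'a \<Rightarrow> bool list \<Rightarrow> 'a"
  where "child k x = (SOME f. range f \<subseteq> X \<and>
    (\<forall>y\<in>target k x. \<exists>w. length w = width k \<and> d (f w) y \<le> (1/2) ^ Suc (N k)))"

text \<open>Any point will do: \<open>target 0\<close> is the whole space, so the root restricts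
  nothing.\<close>

definition root :: 'a
  where "root = (SOME x. x \<in> X)"

primrec node :: "nat \<Rightarrow> cantor \<Rightarrow> 'a"
  where "node 0 u = root"
  | "node (Suc k) u = child k (node k u) (map u [offset k..<offset (Suc k)])"

definition tree_rep :: "cantor \<rightharpoonup> 'a"
  where "tree_rep u = (if \<exists>x\<in>X. \<forall>k. d (node (Suc k) u) x \<le> (1/2) ^ N k
    then Some (SOME x. x \<in> X \<and> (\<forall>k. d (node (Suc k) u) x \<le> (1/2) ^ N k)) else None)"

lemma child:
  assumes "x \<in> X"
  shows child_in: "child k x w \<in> X"
    and child_net: "y \<in> target k x \<Longrightarrow>
      \<exists>w. length w = width k \<and> d (child k x w) y \<le> (1/2) ^ Suc (N k)"
proof -
  have sub: "target k x \<subseteq> X" "target k x \<noteq> {}"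
  proof -
    have "x \<in> target k x"
      using assms by (simp add: target_def split: nat.split)
    then show "target k x \<noteq> {}"
      by blast
  qed (auto simp: target_def split: nat.splits)
  \<comment> \<open>The relative entropy is a supremum over all centers, so one width serves all
    nodes of depth \<open>k\<close>.\<close>
  have "unary_entropy (target k x) d (Suc (N k)) \<le> 2 ^ width k"
    using unary_entropy_le_2_power[of X d "Suc (N 0)"] unary_entropy_mcball_le[OF assms]
    by (cases k) (simp_all add: target_def width_def)
  then have "\<exists>f :: bool list \<Rightarrow> 'a. range f \<subseteq> X \<and>
      (\<forall>y\<in>target k x. \<exists>w. length w = width k \<and> d (f w) y \<le> (1/2) ^ Suc (N k))"
    by (rule net_indexed_by_words[OF sub])
  from someI_ex[OF this, folded child_def] show "child k x w \<in> X"
    and "y \<in> target k x \<Longrightarrow> \<exists>w. length w = width k \<and> d (child k x w) y \<le> (1/2) ^ Suc (N k)"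
    by blast+
qed

section \<open>Nodes, offsets and the points described by a path\<close>

lemma root_in: "x \<in> X \<Longrightarrow> root \<in> X"
  unfolding root_def by (rule someI)

lemma node_in:
  assumes "x \<in> X"
  shows "node k u \<in> X"
  by (induction k) (simp_all add: root_in[OF assms] child_in)

lemma offset_0 [simp]: "offset 0 = 0"
  by (simp add: offset_def)

lemma offset_Suc [simp]: "offset (Suc k) = offset k + width k"
  by (simp add: offset_def)

lemma mono_offset: "j \<le> k \<Longrightarrow> offset j \<le> offset k"
  unfolding offset_def by (rule sum_mono2) auto

lemma node_cong: "(\<forall>i<offset k. u i = v i) \<Longrightarrow> node k u = node k v"
proof (induction k)
  case (Suc k)
  then have "map u [offset k..<offset (Suc k)] = map v [offset k..<offset (Suc k)]"
    and "node k u = node k v"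
    by (auto intro: map_cong)
  then show ?case
    unfolding node.simps by (simp only:)
qed simp

lemma le_N: "k \<le> N k"
  using strict_mono_N by (rule strict_mono_imp_increasing)

lemma N_mono: "j \<le> k \<Longrightarrow> N j \<le> N k"
  using strict_mono_N by (simp add: strict_mono_less_eq)

lemma N_less_Suc: "Suc (N k) \<le> N (Suc k)"
  using strict_mono_N by (simp add: strict_mono_less Suc_le_eq)

text \<open>The detour through the common node costs a factor of two, and one step of the strictly
  increasing \<open>N\<close> pays for it.\<close>

lemma near_common_node:
  assumes "x \<in> X" "x' \<in> X" "z \<in> X" "d z x \<le> (1/2) ^ N (Suc k)" "d z x' \<le> (1/2) ^ N (Suc k)"
  shows "d x x' \<le> (1/2) ^ N k"
proof -
  have "d x x' \<le> d z x + d z x'"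
    using triangle''[of x z x'] assms(1-3) triangle[of x z x'] commute[of x z] by simp
  also have "\<dots> \<le> 2 * (1/2) ^ N (Suc k)"
    using assms by simp
  also have "\<dots> \<le> 2 * (1/2) ^ Suc (N k)"
    using power_decreasing[OF N_less_Suc[of k], of "1/2 :: real"] by simp
  finally show ?thesis
    by simp
qed

text \<open>The choice in \<open>tree_rep\<close> is forced: two points described by the same path
  share nodes of every precision, so their distance is below every power of 1/2.\<close>

lemma tree_rep_eq_Some:
  "tree_rep u = Some x \<longleftrightarrow> x \<in> X \<and> (\<forall>k. d (node (Suc k) u) x \<le> (1/2) ^ N k)"
  (is "_ \<longleftrightarrow> ?P x")
proof -
  have unique: "x = x'" if "?P x" "?P x'" for x x'
  proof (rule ccontr)
    assume "x \<noteq> x'"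
    with that have "0 < d x x'"
      by simp
    then obtain k where k: "(1/2) ^ k < d x x'"
      using real_arch_pow_inv[of "d x x'" "1/2"] by fastforce
    have "d x x' \<le> (1/2) ^ N k"
      using that node_in by (intro near_common_node[of x x' "node (Suc (Suc k)) u"]) blast+
    also have "(1/2 :: real) ^ N k \<le> (1/2) ^ k"
      using le_N by (intro power_decreasing) auto
    finally show False
      using k by simp
  qed
  show ?thesis
  proof
    assume "tree_rep u = Some x"
    then have ex: "\<exists>x. ?P x" and x: "x = (SOME x. ?P x)"
      unfolding tree_rep_def by (auto split: if_splits)
    show "?P x"
      unfolding x using ex by (rule someI_ex)
  next
    assume x: "?P x"
    then have "(SOME x. ?P x) = x"
      by (rule some_equality) (rule unique[OF _ x])
    with x show "tree_rep u = Some x"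
      unfolding tree_rep_def by auto
  qed
qed

lemma ran_tree_rep_subset: "ran tree_rep \<subseteq> X"
  by (auto simp: ran_def tree_rep_eq_Some)

text \<open>
  The greedy name of a sequence \<open>y\<close> of points: the \<open>k\<close>-th child is chosen within the mesh around
  \<open>y k\<close>. It describes the limit of \<open>y\<close> if \<open>y\<close> converges fast, and its first \<open>offset k\<close> digits depend
  only on \<open>y 0, \<dots>, y (k - 1)\<close>.
\<close>

definition greedy_word :: "nat \<Rightarrow> 'a \<Rightarrow> 'a \<Rightarrow> bool list"
  where "greedy_word k x y =
    (SOME w. length w = width k \<and> d (child k x w) y \<le> (1/2) ^ Suc (N k))"

primrec greedy_node :: "(nat \<Rightarrow> 'a) \<Rightarrow> nat \<Rightarrow> 'a"
  where "greedy_node y 0 = root"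
  | "greedy_node y (Suc k) = child k (greedy_node y k) (greedy_word k (greedy_node y k) (y k))"

text \<open>
  The value of \<open>level i\<close> is unspecified if \<open>i\<close> lies beyond all offsets, as can happen for
  finite spaces; greedy names are padded with \<open>False\<close> there.
\<close>

definition level :: "nat \<Rightarrow> nat"
  where "level i = (LEAST k. i < offset (Suc k))"

definition name :: "(nat \<Rightarrow> 'a) \<Rightarrow> cantor"
  where "name y i \<longleftrightarrow> (\<exists>k. i < offset (Suc k)) \<and>
    greedy_word (level i) (greedy_node y (level i)) (y (level i)) ! (i - offset (level i))"

lemma level_eq:
  assumes "offset k \<le> i" "i < offset (Suc k)"
  shows "level i = k"
  unfolding level_def
proof (rule Least_equality)
  show "k \<le> j" if "i < offset (Suc j)" for j
  proof (rule ccontr)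
    assume "\<not> k \<le> j"
    then have "offset (Suc j) \<le> offset k"
      by (intro mono_offset) simp
    with assms that show False
      by simp
  qed
qed (rule assms(2))

lemma level_less:
  assumes "i < offset k"
  shows "level i < k"
proof (cases k)
  case (Suc j)
  with assms have "level i \<le> j"
    unfolding level_def by (intro Least_le) simp
  with Suc show ?thesis
    by simp
qed (use assms in simp)

lemma greedy_node_cong: "\<forall>j<k. y j = y' j \<Longrightarrow> greedy_node y k = greedy_node y' k"
  by (induction k) auto

text \<open>Positions beyond all offsets carry \<open>False\<close> for every sequence, so
  \<open>i < offset k\<close> is demanded only of positions that lie in some block.\<close>

lemma name_cong:
  assumes "\<forall>j<k. y j = y' j" "(\<exists>j. i < offset (Suc j)) \<longrightarrow> i < offset k"
  shows "name y i = name y' i"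
proof (cases "\<exists>j. i < offset (Suc j)")
  case True
  with assms(2) have "level i < k"
    by (intro level_less) simp
  then show ?thesis
    unfolding name_def using assms(1) greedy_node_cong[of "level i" y y'] by auto
qed (simp add: name_def)

text \<open>The tolerance equals the greedy mesh, so that the two errors together stay within the
  radius \<open>(1/2) ^ N k\<close> of the ball whose net is searched next.\<close>

definition fast :: "(nat \<Rightarrow> 'a) \<Rightarrow> bool"
  where "fast y \<longleftrightarrow> (\<forall>k. y k \<in> X \<and> d (y k) (y (Suc k)) \<le> (1/2) ^ Suc (N k))"

lemma greedy_node_in:
  assumes "fast y"
  shows "greedy_node y k \<in> X"
proof (induction k)
  case 0
  have "y 0 \<in> X"
    using assms by (simp add: fast_def)
  then show ?case
    by (simp add: root_in)
qed (simp add: child_in)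

lemma half_plus_half:
  assumes "x \<in> X" "y \<in> X" "z \<in> X" "d x y \<le> (1/2) ^ Suc n" "d y z \<le> (1/2) ^ Suc n"
  shows "d x z \<le> (1/2) ^ n"
  using triangle[of x y z] assms by simp

lemma greedy_step:
  assumes "fast y"
  shows "length (greedy_word k (greedy_node y k) (y k)) = width k \<and>
    d (greedy_node y (Suc k)) (y k) \<le> (1/2) ^ Suc (N k)"
proof -
  have y: "y j \<in> X" for j
    using assms by (simp add: fast_def)
  have step: "length (greedy_word k (greedy_node y k) (y k)) = width k \<and>
      d (greedy_node y (Suc k)) (y k) \<le> (1/2) ^ Suc (N k)"
    if "y k \<in> target k (greedy_node y k)" for k
    unfolding greedy_node.simps greedy_word_def
    by (rule someI_ex[OF child_net[OF greedy_node_in[OF assms] that]])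
  \<comment> \<open>The greedy word is a \<open>SOME\<close> choice and needs a witness. This
    membership provides one, and the resulting closeness carries the membership to the next
    depth.\<close>
  have "y k \<in> target k (greedy_node y k)"
  proof (induction k)
    case 0
    show ?case
      by (simp add: target_def y)
  next
    case (Suc k)
    have "d (greedy_node y (Suc k)) (y (Suc k)) \<le> (1/2) ^ N k"
    proof (rule half_plus_half[OF greedy_node_in[OF assms] y y])
      show "d (greedy_node y (Suc k)) (y k) \<le> (1/2) ^ Suc (N k)"
        using step[OF Suc] by blast
      show "d (y k) (y (Suc k)) \<le> (1/2) ^ Suc (N k)"
        using assms unfolding fast_def by blast
    qed
    then show ?case
      unfolding target_def using y greedy_node_in[OF assms, of "Suc k"] by simp
  qed
  then show ?thesis
    by (rule step)
qed

lemma node_name: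
  assumes "fast y"
  shows "node k (name y) = greedy_node y k"
proof (induction k)
  case (Suc k)
  let ?w = "greedy_word k (greedy_node y k) (y k)"
  have "map (name y) [offset k..<offset (Suc k)] = ?w"
  proof (rule nth_equalityI)
    fix j assume "j < length (map (name y) [offset k..<offset (Suc k)])"
    then have j: "j < width k"
      by simp
    then have "level (offset k + j) = k"
      by (intro level_eq) auto
    moreover from j have "\<exists>k'. offset k + j < offset (Suc k')"
      by (intro exI[of _ k]) simp
    ultimately have "name y (offset k + j) = ?w ! j"
      unfolding name_def by simp
    with j show "map (name y) [offset k..<offset (Suc k)] ! j = ?w ! j"
      by simp
  qed (use greedy_step[OF assms] in simp)
  with Suc show ?case
    by (simp del: offset_Suc)
qed simp

text \<open>Half of the admissible distance is spent on the greedy choice, the other half on the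
  distance from \<open>y k\<close> to the limit.\<close>

lemma tree_rep_name:
  assumes "fast y" "x \<in> X" "\<And>k. d (y k) x \<le> (1/2) ^ Suc (N k)"
  shows "tree_rep (name y) = Some x"
  unfolding tree_rep_eq_Some node_name[OF assms(1)]
proof (intro conjI allI)
  show "d (greedy_node y (Suc k)) x \<le> (1/2) ^ N k" for k
  proof (rule half_plus_half[OF greedy_node_in[OF assms(1)] _ assms(2) _ assms(3)])
    show "y k \<in> X"
      using assms(1) unfolding fast_def by blast
    show "d (greedy_node y (Suc k)) (y k) \<le> (1/2) ^ Suc (N k)"
      using greedy_step[OF assms(1)] by blast
  qed
qed (rule assms(2))

section \<open>Surjectivity and the number of nodes\<close>

lemma fast_const: "x \<in> X \<Longrightarrow> fast (\<lambda>_. x)"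
  by (simp add: fast_def)

lemma tree_rep_name_const:
  "x \<in> X \<Longrightarrow> tree_rep (name (\<lambda>_. x)) = Some x"
  by (rule tree_rep_name[OF fast_const]) simp_all

lemma representation_tree_rep: "representation_of X tree_rep"
  unfolding representation_of_def
proof
  show "X \<subseteq> ran tree_rep"
  proof
    fix x assume "x \<in> X"
    then have "tree_rep (name (\<lambda>_. x)) = Some x"
      by (rule tree_rep_name_const)
    then show "x \<in> ran tree_rep"
      by (meson ranI)
  qed
qed (rule ran_tree_rep_subset)

text \<open>The nodes of depth \<open>Suc k\<close> form a net, because the greedy name of a
  constant sequence passes within the mesh of its point. Each node is determined by
  \<open>offset (Suc k)\<close> digits, which bounds their number.\<close>

lemma binary_entropy_le_offset:
  assumes "x \<in> X"
  shows "binary_entropy X d (Suc (N k)) \<le> offset (Suc k)"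
proof -
  let ?words = "{w :: bool list. length w = offset (Suc k)}"
  \<comment> \<open>Past the end of \<open>w\<close> the digits are unspecified; the node does not
    read them.\<close>
  let ?f = "\<lambda>w. node (Suc k) (\<lambda>i. w ! i)"
  have words: "finite ?words" "card ?words = 2 ^ offset (Suc k)"
    using card_lists_length_eq[of "UNIV :: bool set" "offset (Suc k)"]
      finite_lists_length_eq[of "UNIV :: bool set" "offset (Suc k)"] by simp_all
  have "unary_entropy X d (Suc (N k)) \<le> card (?f ` ?words)"
  proof (rule unary_entropy_le)
    show "?f ` ?words \<subseteq> X"
      using node_in[OF assms] by blast
    show "\<exists>c\<in>?f ` ?words. d c y \<le> (1/2) ^ Suc (N k)" if y: "y \<in> X" for y
    proof -
      let ?u = "name (\<lambda>_. y)"
      have fast: "fast (\<lambda>_. y)"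
        using y by (rule fast_const)
      have "node (Suc k) ?u = ?f (map ?u [0..<offset (Suc k)])"
        by (rule node_cong) simp
      then have "node (Suc k) ?u \<in> ?f ` ?words"
        by (rule image_eqI) simp
      moreover have "d (node (Suc k) ?u) y \<le> (1/2) ^ Suc (N k)"
        unfolding node_name[OF fast] using greedy_step[OF fast, of k] by blast
      ultimately show ?thesis ..
    qed
  qed (use words in auto)
  also have "\<dots> \<le> 2 ^ offset (Suc k)"
    using card_image_le[OF words(1)] words(2) by metis
  finally show ?thesis
    unfolding binary_entropy_def by (rule nat_ceiling_log2_le)
qed

section \<open>The modulus of continuity and the induced semi-metric\<close>

definition index :: "nat \<Rightarrow> nat"
  where "index n = (LEAST k. n \<le> N k)"

lemma le_N_index: "n \<le> N (index n)"
  unfolding index_def by (rule LeastI[of "\<lambda>k. n \<le> N k", OF le_N])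

lemma index_le: "n \<le> N k \<Longrightarrow> index n \<le> k"
  unfolding index_def by (rule Least_le)

lemma index_N [simp]: "index (N k) = k"
  using index_le[of "N k" k] le_N_index[of "N k"] strict_mono_N by (simp add: strict_mono_less_eq)

text \<open>The absolute entropy is the width of block 0 and the sum over \<open>k = 0..K\<close>
  collects blocks 1 to \<open>K + 1\<close>, so the modulus counts the digits that determine a node
  of depth \<open>K + 2\<close>.\<close>

lemma sequence_modulus_eq: "sequence_modulus X d N n = offset (Suc (Suc (index n)))"
proof -
  have "offset (Suc (Suc K)) = width 0 + (\<Sum>k=0..K. width (Suc k))" for K
    unfolding offset_def lessThan_Suc_atMost atMost_atLeast0
    by (simp only: sum.atLeast0_atMost_Suc_shift o_def)
  then show ?thesis
    by (simp add: sequence_modulus_def Let_def index_def width_def)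
qed

text \<open>A node of depth \<open>K + 2\<close> has precision \<open>N (K + 1)\<close>, one step
  finer than the target \<open>N K\<close>, as \<open>near_common_node\<close> requires.\<close>

lemma map_modulus_tree_rep: "map_modulus d tree_rep (sequence_modulus X d N)"
  unfolding map_modulus_def modulus_of_def
proof (intro conjI allI ballI impI)
  show "mono (sequence_modulus X d N)"
  proof (rule monoI)
    fix m n :: nat assume "m \<le> n"
    then have "m \<le> N (index n)"
      using le_N_index by (rule order_trans)
    then have "index m \<le> index n"
      by (rule index_le)
    then show "sequence_modulus X d N m \<le> sequence_modulus X d N n"
      unfolding sequence_modulus_eq by (intro mono_offset) simp
  qed
next
  fix n u u'
  assume "u \<in> dom tree_rep" "u' \<in> dom tree_rep"
  then obtain x x' where x: "tree_rep u = Some x" "tree_rep u' = Some x'"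
    by blast
  assume "cantor_dist u u' \<le> (1/2) ^ sequence_modulus X d N n"
  then have node: "node (Suc (Suc (index n))) u = node (Suc (Suc (index n))) u'"
    unfolding cantor_dist_le_iff sequence_modulus_eq by (rule node_cong)
  have "d x x' \<le> (1/2) ^ N (index n)"
  proof (rule near_common_node)
    show "d (node (Suc (Suc (index n))) u) x \<le> (1/2) ^ N (Suc (index n))"
      using x(1) unfolding tree_rep_eq_Some by blast
    show "d (node (Suc (Suc (index n))) u) x' \<le> (1/2) ^ N (Suc (index n))"
      unfolding node using x(2) unfolding tree_rep_eq_Some by blast
  qed (use x node_in in \<open>unfold tree_rep_eq_Some, blast+\<close>)
  also have "\<dots> \<le> (1/2) ^ n"
    by (intro power_decreasing le_N_index) auto
  finally show "d ((the \<circ> tree_rep) u) ((the \<circ> tree_rep) u') \<le> (1/2) ^ n"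
    using x by simp
qed

lemma induced_semimetric_tree_rep:
  assumes "x \<in> X" "x' \<in> X" "d x x' \<le> (1/2) ^ Suc (N (index n))"
  shows "induced_semimetric tree_rep x x' \<le> (1/2) ^ binary_entropy X d n"
proof -
  let ?k = "index n"
  \<comment> \<open>The jump from \<open>x\<close> to \<open>x'\<close> follows stage
    \<open>?k\<close>, where the hypothesis just meets the tolerance of \<open>fast\<close>. The
    names of \<open>x\<close> and of \<open>y\<close> then agree on \<open>Suc ?k\<close> blocks,
    which hold at least as many digits as the entropy at \<open>n\<close>.\<close>
  define y where "y j = (if j \<le> ?k then x else x')" for j
  have close: "d x x' \<le> (1/2) ^ Suc (N j)" if "j \<le> ?k" for j
  proof -
    have "(1/2 :: real) ^ Suc (N ?k) \<le> (1/2) ^ Suc (N j)"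
      using N_mono[OF that] by (intro power_decreasing) auto
    with assms(3) show ?thesis
      by (rule order_trans)
  qed
  have "fast y"
    unfolding fast_def y_def using assms close by auto
  moreover have "d (y j) x' \<le> (1/2) ^ Suc (N j)" for j
    unfolding y_def using assms close by auto
  ultimately have x': "tree_rep (name y) = Some x'"
    by (intro tree_rep_name assms(2))
  have "\<forall>i<offset (Suc ?k). name (\<lambda>_. x) i = name y i"
    by (intro allI impI name_cong[of "Suc ?k"]) (auto simp: y_def)
  then have "cantor_dist (name (\<lambda>_. x)) (name y) \<le> (1/2) ^ offset (Suc ?k)"
    unfolding cantor_dist_le_iff .
  moreover have "binary_entropy X d n \<le> offset (Suc ?k)"
    using binary_entropy_mono[of n "Suc (N ?k)"] le_N_index[of n]
      binary_entropy_le_offset[OF assms(1), of ?k] by linarith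
  then have "(1/2 :: real) ^ offset (Suc ?k) \<le> (1/2) ^ binary_entropy X d n"
    by (intro power_decreasing) auto
  ultimately show ?thesis
    using induced_semimetric_le[OF Metric_space_axioms ran_tree_rep_subset map_modulus_tree_rep
        tree_rep_name_const[OF assms(1)] x'] by linarith
qed

section \<open>Reductions to the tree representation\<close>

lemma offset_saturates: "\<exists>k. \<forall>i<m. (\<exists>j. i < offset (Suc j)) \<longrightarrow> i < offset k"
proof (induction m)
  case (Suc m)
  then obtain k where k: "\<forall>i<m. (\<exists>j. i < offset (Suc j)) \<longrightarrow> i < offset k"
    by blast
  \<comment> \<open>Offsets may stay bounded. If \<open>m\<close> lies beyond all of them,
    \<open>j\<close> is unspecified, but then nothing is claimed about \<open>m\<close>.\<close>
  define j where "j = (LEAST j. m < offset (Suc j))"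
  have j: "m < offset (Suc j)" if "\<exists>j. m < offset (Suc j)"
    unfolding j_def using that by (rule LeastI_ex)
  have "offset k \<le> offset (max k (Suc j))" "offset (Suc j) \<le> offset (max k (Suc j))"
    by (intro mono_offset, simp)+
  then have "\<forall>i<Suc m. (\<exists>j. i < offset (Suc j)) \<longrightarrow> i < offset (max k (Suc j))"
    using k j unfolding less_Suc_eq by (metis order_less_le_trans)
  then show ?case
    by blast
qed simp

text \<open>
  To translate a name \<open>u\<close>, feed the greedy coder with points having a name that shares a long
  enough initial segment with \<open>u\<close>.
\<close>

lemma translation_to_tree_rep:
  assumes ran: "ran \<xi> \<subseteq> X" and \<mu>: "map_modulus d \<xi> \<mu>"
  obtains G where "\<And>u. u \<in> dom \<xi> \<Longrightarrow> tree_rep (G u) = \<xi> u"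
    "\<And>k i u u'. \<forall>i<\<mu> (Suc (N k)). u i = u' i \<Longrightarrow>
      (\<exists>j. i < offset (Suc j)) \<longrightarrow> i < offset (Suc k) \<Longrightarrow> G u i = G u' i"
proof -
  have mono: "mono \<mu>"
    using \<mu> by (simp add: map_modulus_def modulus_of_def)
  \<comment> \<open>The predicate sees only an initial segment of \<open>u\<close>, so inputs that
    agree there get the same \<open>v k u\<close> and the same point. Using \<open>\<xi> u\<close>
    itself would read all of \<open>u\<close>.\<close>
  define v where "v k u = (SOME v. v \<in> dom \<xi> \<and> (\<forall>i<\<mu> (Suc (N k)). v i = u i))" for k u
  define y where "y u k = the (\<xi> (v k u))" for u k
  have v: "v k u \<in> dom \<xi> \<and> (\<forall>i<\<mu> (Suc (N k)). v k u i = u i)" if "u \<in> dom \<xi>" for k u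
    unfolding v_def by (rule someI[of _ u]) (use that in simp)
  have y: "\<xi> (v k u) = Some (y u k)" if "u \<in> dom \<xi>" for k u
    unfolding y_def using v[OF that, of k] by auto
  have y_in: "y u k \<in> X" if "u \<in> dom \<xi>" for u k
    using ran y[OF that] by (meson ranI subsetD)
  have "tree_rep (name (y u)) = \<xi> u" if u: "u \<in> dom \<xi>" for u
  proof -
    obtain x where x: "\<xi> u = Some x"
      using u by blast
    have "d (y u k) (y u (Suc k)) \<le> (1/2) ^ Suc (N k)" for k
    proof (rule map_modulusD[OF \<mu> y[OF u] y[OF u]])
      have "\<mu> (Suc (N k)) \<le> \<mu> (Suc (N (Suc k)))"
        using mono N_mono[of k "Suc k"] by (simp add: monoD)
      then show "\<forall>i<\<mu> (Suc (N k)). v k u i = v (Suc k) u i"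
        using v[OF u, of k] v[OF u, of "Suc k"] by simp
    qed
    then have "fast (y u)"
      using y_in[OF u] by (simp add: fast_def)
    moreover have "d (y u k) x \<le> (1/2) ^ Suc (N k)" for k
      using v[OF u, of k] by (intro map_modulusD[OF \<mu> y[OF u] x]) blast
    moreover have "x \<in> X"
      using ran x by (meson ranI subsetD)
    ultimately show ?thesis
      unfolding x by (intro tree_rep_name)
  qed
  moreover have "name (y u) i = name (y u') i"
    if u: "\<forall>i<\<mu> (Suc (N k)). u i = u' i" and i: "(\<exists>j. i < offset (Suc j)) \<longrightarrow> i < offset (Suc k)"
    for k i u u'
  proof (rule name_cong[OF _ i], intro allI impI)
    fix j assume "j < Suc k"
    then have "\<mu> (Suc (N j)) \<le> \<mu> (Suc (N k))"
      using mono N_mono[of j k] by (simp add: monoD)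
    with u have "(\<forall>i<\<mu> (Suc (N j)). v i = u i) \<longleftrightarrow> (\<forall>i<\<mu> (Suc (N j)). v i = u' i)" for v
      by (simp add: order_less_le_trans[of _ "\<mu> (Suc (N j))" "\<mu> (Suc (N k))"])
    then show "y u j = y u' j"
      unfolding y_def v_def by simp
  qed
  ultimately show thesis
    by (rule that)
qed

text \<open>The modulus of \<open>tree_rep\<close> at \<open>n\<close> asks for at most
  \<open>index n + 2\<close> blocks of output. The last of these has index
  \<open>Suc (index n)\<close> and needs input of precision \<open>Suc (N (Suc (index n)))\<close>,
  hence the hypothesis on \<open>b\<close>.\<close>

lemma reducible_to_tree_rep:
  assumes ran: "ran \<xi> \<subseteq> X" and "map_modulus d \<xi> \<mu>"
    and c: "\<And>n. Suc (N (Suc (index n))) \<le> b c n"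
  shows "reducible b d \<xi> tree_rep"
proof -
  let ?\<mu> = "map_min_modulus d \<xi>"
  have min: "map_modulus d \<xi> ?\<mu>"
    using assms(2) by (rule map_modulus_min)
  then have mono: "mono ?\<mu>"
    by (simp add: map_modulus_def modulus_of_def)
  obtain G where G: "\<And>u. u \<in> dom \<xi> \<Longrightarrow> tree_rep (G u) = \<xi> u"
    "\<And>k i u u'. \<forall>i<?\<mu> (Suc (N k)). u i = u' i \<Longrightarrow>
      (\<exists>j. i < offset (Suc j)) \<longrightarrow> i < offset (Suc k) \<Longrightarrow> G u i = G u' i"
    by (rule translation_to_tree_rep[OF ran min]) blast
  have ex: "\<exists>l. \<forall>u\<in>dom \<xi>. \<forall>u'\<in>dom \<xi>.
      cantor_dist u u' \<le> (1/2) ^ l \<longrightarrow> cantor_dist (G u) (G u') \<le> (1/2) ^ m" for m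
  proof -
    obtain k where "\<forall>i<m. (\<exists>j. i < offset (Suc j)) \<longrightarrow> i < offset k"
      using offset_saturates ..
    moreover have "offset k \<le> offset (Suc k)"
      by simp
    ultimately have "\<forall>i<m. (\<exists>j. i < offset (Suc j)) \<longrightarrow> i < offset (Suc k)"
      by (meson order_less_le_trans)
    then show ?thesis
      unfolding cantor_dist_le_iff by (intro exI[of _ "?\<mu> (Suc (N k))"]) (use G(2) in blast)
  qed
  \<comment> \<open>With the minimal modulus of \<open>G\<close>, the bound at \<open>n\<close>
    needs checking at a single output precision only.\<close>
  define \<nu> where "\<nu> = minimal_modulus (dom \<xi>) cantor_dist cantor_dist G"
  have "\<nu> (map_min_modulus d tree_rep n) \<le> ?\<mu> (b c n)" for n
    unfolding \<nu>_def
  proof (rule minimal_modulus_le[of "dom \<xi>" cantor_dist cantor_dist G, OF ex])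
    fix u u' assume "cantor_dist u u' \<le> (1/2) ^ ?\<mu> (b c n)"
    moreover have "?\<mu> (Suc (N (Suc (index n)))) \<le> ?\<mu> (b c n)"
      using mono c by (rule monoD)
    ultimately have "\<forall>i<?\<mu> (Suc (N (Suc (index n)))). u i = u' i"
      unfolding cantor_dist_le_iff by (meson order_less_le_trans)
    from G(2)[OF this]
    have "\<forall>i<offset (Suc (Suc (index n))). G u i = G u' i"
      by blast
    moreover have "map_min_modulus d tree_rep n \<le> offset (Suc (Suc (index n)))"
      using map_min_modulus_le[OF map_modulus_tree_rep] unfolding sequence_modulus_eq .
    ultimately show "cantor_dist (G u) (G u') \<le> (1/2) ^ map_min_modulus d tree_rep n"
      unfolding cantor_dist_le_iff by (meson order_less_le_trans)
  qed
  moreover have "modulus_of (dom \<xi>) cantor_dist cantor_dist G \<nu>"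
    unfolding \<nu>_def by (rule modulus_of_minimal[of "dom \<xi>" cantor_dist cantor_dist G, OF ex])
  moreover have "G \<in> dom \<xi> \<rightarrow> dom tree_rep" "\<forall>u\<in>dom \<xi>. \<xi> u = tree_rep (G u)"
    using G(1) by (auto simp: dom_def)
  ultimately show ?thesis
    unfolding reducible_def by blast
qed

section \<open>Growth bounds\<close>

text \<open>If \<open>index n = Suc k\<close> then \<open>N k < n\<close>, so rounding
  \<open>n\<close> up costs one application of \<open>g\<close>; the summand \<open>N 0\<close>
  covers index 0.\<close>

lemma N_index_le:
  assumes "\<And>m n. m \<le> n \<Longrightarrow> g m \<le> g n" "\<And>k. N (Suc k) \<le> g (N k)"
  shows "N (index n) \<le> N 0 + g n"
proof (cases "index n")
  case (Suc k)
  then have "\<not> n \<le> N k"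
    using index_le[of n k] by auto
  then have "g (N k) \<le> g n"
    by (intro assms(1)) simp
  with assms(2)[of k] Suc show ?thesis
    by simp
qed simp

text \<open>Treats both growth classes at once. Rounding \<open>n\<close> up to a precision of the
  sequence costs one application of \<open>b c\<close>, the next precision or the entropy bound
  another; \<open>comp\<close> absorbs both and a successor in one constant.\<close>

lemma standard_tree_rep:
  assumes mono: "\<And>c m n. m \<le> n \<Longrightarrow> b c m \<le> b c n"
    and comp: "\<And>a c. \<exists>c'. \<forall>n. Suc (b c (a + b c n)) \<le> b c' n"
    and N: "\<And>k. N (Suc k) \<le> b c (N k)"
    and entropy: "\<And>K. sequence_modulus X d N (N K) \<le> binary_entropy X d (b c (N K))"
  shows "\<exists>c'. (\<forall>n. map_min_modulus d tree_rep n \<le> binary_entropy X d (b c' n)) \<and>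
    (\<forall>\<xi>. ran \<xi> \<subseteq> X \<and> (\<exists>\<mu>. map_modulus d \<xi> \<mu>) \<longrightarrow> reducible b d \<xi> tree_rep) \<and>
    (\<forall>n. \<forall>x\<in>X. \<forall>x'\<in>X. d x x' \<le> (1/2) ^ b c' n \<longrightarrow>
      induced_semimetric tree_rep x x' \<le> (1/2) ^ binary_entropy X d n)"
proof -
  obtain c' where c': "\<And>n. Suc (b c (N 0 + b c n)) \<le> b c' n"
    using comp[of c "N 0"] by blast
  have index: "Suc (b c (N (index n))) \<le> b c' n" for n
    using mono[OF N_index_le[of "b c" n], OF mono N, of c] c'[of n] by linarith
  have Suc_index: "Suc (N (Suc (index n))) \<le> b c' n" for n
    using N[of "index n"] index[of n] by linarith
  show ?thesis
  proof (intro exI[of _ c'] conjI allI ballI impI)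
    fix n
    have "map_min_modulus d tree_rep n \<le> sequence_modulus X d N n"
      by (rule map_min_modulus_le[OF map_modulus_tree_rep])
    \<comment> \<open>The modulus is constant between consecutive precisions, so the entropy
      hypothesis at \<open>N K\<close> reaches every \<open>n\<close>.\<close>
    also have "\<dots> = sequence_modulus X d N (N (index n))"
      by (simp only: sequence_modulus_eq index_N)
    also have "\<dots> \<le> binary_entropy X d (b c (N (index n)))"
      by (rule entropy)
    also have "\<dots> \<le> binary_entropy X d (b c' n)"
      using index[of n] by (intro binary_entropy_mono) simp
    finally show "map_min_modulus d tree_rep n \<le> binary_entropy X d (b c' n)" .
  next
    fix \<xi> :: "cantor \<rightharpoonup> 'a" assume "ran \<xi> \<subseteq> X \<and> (\<exists>\<mu>. map_modulus d \<xi> \<mu>)"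
    then obtain \<mu> where "ran \<xi> \<subseteq> X" "map_modulus d \<xi> \<mu>"
      by blast
    then show "reducible b d \<xi> tree_rep"
      using Suc_index by (rule reducible_to_tree_rep[of \<xi> \<mu> b c'])
  next
    fix n x x' assume x: "x \<in> X" "x' \<in> X" and d: "d x x' \<le> (1/2) ^ b c' n"
    have "Suc (N (index n)) \<le> b c' n"
      using N_less_Suc[of "index n"] Suc_index[of n] by linarith
    then have "(1/2 :: real) ^ b c' n \<le> (1/2) ^ Suc (N (index n))"
      by (intro power_decreasing) auto
    with d have "d x x' \<le> (1/2) ^ Suc (N (index n))"
      by (rule order_trans)
    with x show "induced_semimetric tree_rep x x' \<le> (1/2) ^ binary_entropy X d n"
      by (rule induced_semimetric_tree_rep)
  qed
qed

end

section \<open>Composition of linear and of polynomial bounds\<close>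

lemma linear_bound_comp: "\<exists>c'. \<forall>n. Suc (c + c * (a + (c + c * n))) \<le> c' + c' * (n :: nat)"
  by (rule exI[of _ "Suc (c + c * a + c * c)"]) (simp add: algebra_simps)

lemma polynomial_bound_comp: "\<exists>c'. \<forall>n. Suc (c + c * (a + (c + c * n ^ c)) ^ c) \<le> c' + c' * (n :: nat) ^ c'"
proof (intro exI allI)
  fix n :: nat
  let ?B = "(a + 2 * c) ^ c"
  \<comment> \<open>One number is both coefficient and exponent: \<open>Suc c\<close> takes the
    additive part, \<open>c * ?B\<close> the coefficient and \<open>c * c\<close> the
    degree.\<close>
  let ?c = "Suc c + c * ?B + c * c"
  show "Suc (c + c * (a + (c + c * n ^ c)) ^ c) \<le> ?c + ?c * n ^ ?c"
  proof (cases "n = 0")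
    case True
    then have "a + (c + c * n ^ c) \<le> a + 2 * c"
      \<comment> \<open>For \<open>c = 0\<close> the power is \<open>0 ^ 0 = 1\<close>, but its
        coefficient vanishes.\<close>
      by (cases c) auto
    then have "(a + (c + c * n ^ c)) ^ c \<le> ?B"
      by (rule power_mono) simp
    then have "c * (a + (c + c * n ^ c)) ^ c \<le> c * ?B"
      by (rule mult_le_mono2)
    then show ?thesis
      by linarith
  next
    case False
    then have "1 \<le> n ^ c"
      by simp
    then have "(a + c) * 1 \<le> (a + c) * n ^ c"
      by (rule mult_le_mono2)
    then have "a + (c + c * n ^ c) \<le> (a + 2 * c) * n ^ c"
      by (simp add: algebra_simps)
    then have "(a + (c + c * n ^ c)) ^ c \<le> ((a + 2 * c) * n ^ c) ^ c"
      by (rule power_mono) simp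
    also have "\<dots> = ?B * n ^ (c * c)"
      by (simp add: power_mult_distrib power_mult)
    also have "\<dots> \<le> ?B * n ^ ?c"
      using False by (intro mult_le_mono2 power_increasing) auto
    finally have "c * (a + (c + c * n ^ c)) ^ c \<le> c * (?B * n ^ ?c)"
      by (rule mult_le_mono2)
    also have "\<dots> = (c * ?B) * n ^ ?c"
      by (simp only: mult.assoc)
    also have "\<dots> \<le> ?c * n ^ ?c"
      by (rule mult_le_mono1) simp
    finally show ?thesis
      by linarith
  qed
qed

section \<open>The linear and the polynomial case\<close>

theorem theorem24:
  fixes X :: "'a set" and d :: "'a \<Rightarrow> 'a \<Rightarrow> real" and N :: "nat \<Rightarrow> nat" and \<mu> :: "nat \<Rightarrow> nat"
  assumes "Metric_space X d"
    and "compact_space (Metric_space.mtopology X d)"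
    and "strict_mono N"
    and "\<And>k. N k > 0"
    and "\<mu> = sequence_modulus X d N"
  shows
    "((\<exists>c. (\<forall>k. N (Suc k) \<le> c + c * N k) \<and>
           (\<forall>K. \<mu> (N K) \<le> binary_entropy X d (c + c * N K)))
        \<longrightarrow> (\<exists>\<xi>. linearly_standard X d \<xi> \<and> map_modulus d \<xi> \<mu>)) \<and>
     ((\<exists>c. (\<forall>k. N (Suc k) \<le> c + c * N k ^ c) \<and>
           (\<forall>K. \<mu> (N K) \<le> binary_entropy X d (c + c * N K ^ c)))
        \<longrightarrow> (\<exists>\<xi>. polynomially_standard X d \<xi> \<and> map_modulus d \<xi> \<mu>))"
proof -
  interpret precision_sequence X d N
    using assms(1-3)
    by (simp add: precision_sequence_def compact_metric_space_def
        compact_metric_space_axioms_def precision_sequence_axioms_def)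
  have \<mu>: "map_modulus d tree_rep \<mu>"
    unfolding assms(5) by (rule map_modulus_tree_rep)
  show ?thesis
  proof (intro conjI impI; elim exE conjE)
    fix c assume c: "\<forall>k. N (Suc k) \<le> c + c * N k"
      "\<forall>K. \<mu> (N K) \<le> binary_entropy X d (c + c * N K)"
    have "\<exists>c. (\<forall>n. map_min_modulus d tree_rep n \<le> binary_entropy X d (c + c * n)) \<and>
      (\<forall>\<xi>. ran \<xi> \<subseteq> X \<and> (\<exists>\<mu>. map_modulus d \<xi> \<mu>) \<longrightarrow>
        reducible (\<lambda>c n. c + c * n) d \<xi> tree_rep) \<and>
      (\<forall>n. \<forall>x\<in>X. \<forall>x'\<in>X. d x x' \<le> (1/2) ^ (c + c * n) \<longrightarrow>
        induced_semimetric tree_rep x x' \<le> (1/2) ^ binary_entropy X d n)"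
    proof (rule standard_tree_rep[of "\<lambda>c n. c + c * n" c])
      show "sequence_modulus X d N (N K) \<le> binary_entropy X d (c + c * N K)" for K
        using c(2) unfolding assms(5) ..
    qed (use c(1) linear_bound_comp in \<open>simp_all\<close>)
    then obtain c' where c': "(\<forall>n. map_min_modulus d tree_rep n \<le> binary_entropy X d (c' + c' * n)) \<and>
      (\<forall>\<xi>. ran \<xi> \<subseteq> X \<and> (\<exists>\<mu>. map_modulus d \<xi> \<mu>) \<longrightarrow> reducible (\<lambda>c n. c + c * n) d \<xi> tree_rep) \<and>
      (\<forall>n. \<forall>x\<in>X. \<forall>x'\<in>X. d x x' \<le> (1/2) ^ (c' + c' * n) \<longrightarrow>
        induced_semimetric tree_rep x x' \<le> (1/2) ^ binary_entropy X d n)" ..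
    have "linearly_standard X d tree_rep"
      unfolding linearly_standard_def linearly_reducible_def
      by (intro conjI exI[of _ \<mu>] exI[of _ c'])
        (rule representation_tree_rep \<mu> c'[THEN conjunct1] c'[THEN conjunct2, THEN conjunct1]
          c'[THEN conjunct2, THEN conjunct2])+
    with \<mu> show "\<exists>\<xi>. linearly_standard X d \<xi> \<and> map_modulus d \<xi> \<mu>"
      by blast
  next
    fix c assume c: "\<forall>k. N (Suc k) \<le> c + c * N k ^ c"
      "\<forall>K. \<mu> (N K) \<le> binary_entropy X d (c + c * N K ^ c)"
    have "\<exists>c. (\<forall>n. map_min_modulus d tree_rep n \<le> binary_entropy X d (c + c * n ^ c)) \<and>
      (\<forall>\<xi>. ran \<xi> \<subseteq> X \<and> (\<exists>\<mu>. map_modulus d \<xi> \<mu>) \<longrightarrow>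
        reducible (\<lambda>c n. c + c * n ^ c) d \<xi> tree_rep) \<and>
      (\<forall>n. \<forall>x\<in>X. \<forall>x'\<in>X. d x x' \<le> (1/2) ^ (c + c * n ^ c) \<longrightarrow>
        induced_semimetric tree_rep x x' \<le> (1/2) ^ binary_entropy X d n)"
    proof (rule standard_tree_rep[of "\<lambda>c n. c + c * n ^ c" c])
      show "sequence_modulus X d N (N K) \<le> binary_entropy X d (c + c * N K ^ c)" for K
        using c(2) unfolding assms(5) ..
    qed (use c(1) polynomial_bound_comp in \<open>simp_all add: power_mono\<close>)
    then obtain c' where c': "(\<forall>n. map_min_modulus d tree_rep n \<le> binary_entropy X d (c' + c' * n ^ c')) \<and>
      (\<forall>\<xi>. ran \<xi> \<subseteq> X \<and> (\<exists>\<mu>. map_modulus d \<xi> \<mu>) \<longrightarrow> reducible (\<lambda>c n. c + c * n ^ c) d \<xi> tree_rep) \<and>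
      (\<forall>n. \<forall>x\<in>X. \<forall>x'\<in>X. d x x' \<le> (1/2) ^ (c' + c' * n ^ c') \<longrightarrow>
        induced_semimetric tree_rep x x' \<le> (1/2) ^ binary_entropy X d n)" ..
    \<comment> \<open>Condition (3) asks for a polynomial with natural coefficients; the bound with
      constant \<open>c'\<close> already is one.\<close>
    define p where "p = [:c':] + monom c' c'"
    have p: "poly p n = c' + c' * n ^ c'" for n
      by (simp add: p_def poly_monom)
    have "polynomially_standard X d tree_rep"
      unfolding polynomially_standard_def polynomially_reducible_def
      by (intro conjI exI[of _ \<mu>] exI[of _ c'] exI[of _ p], unfold p)
        (rule representation_tree_rep \<mu> c'[THEN conjunct1] c'[THEN conjunct2, THEN conjunct1]
          c'[THEN conjunct2, THEN conjunct2])+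
    with \<mu> show "\<exists>\<xi>. polynomially_standard X d \<xi> \<and> map_modulus d \<xi> \<mu>"
      by blast
  qed
qed

end
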